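(* \[ d_{\rm BM}^+\big( C([0,\omega] \times 2), C[0,\omega]\big)\ge \frac{3+\sqrt{17}}{2}>3.56 .\]
   Context: $[0,\omega]$ is the space of ordinals $\le\omega$ with the order topology (a convergent sequence with its limit $\omega$), and $2=\{0,1\}$ is discrete. For a compact Hausdorff space $K$, $C(K)$ is the Banach space of real-valued continuous functions on $K$ with the supremum norm. An isomorphism between Banach spaces is a bounded linear bijection with bounded inverse. An isomorphism $T:C(K)\to C(L)$ is positive if $Tf\ge 0$ whenever $f\ge 0$. The (one-sided) positive Banach--Mazur distance $d_{\rm BM}^+\big(C(K),C(L)\big)$ is the infimum of $\|T\|\cdot\|T^{-1}\|$ over all positive isomorphisms $T:C(K)\to C(L)$. The inverse $T^{-1}$ is not required to be positive, and in general $d_{\rm BM}^+\big(C(K),C(L)\big)\ne d_{\rm BM}^+\big(C(L),C(K)\big)$. *)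

theory Defs
  imports "HOL-Analysis.Analysis"
begin

class compact_hausdorff_space = t2_space +
  assumes compact_UNIV_space: "compact (UNIV :: 'a set)"

instance bool :: compact_hausdorff_space
  by standard (simp add: finite_imp_compact)

instance prod :: (compact_hausdorff_space, compact_hausdorff_space) compact_hausdorff_space
proof
  show "compact (UNIV :: ('a \<times> 'b) set)"
    using compact_Times[OF compact_UNIV_space[where 'a = 'a] compact_UNIV_space[where 'a = 'b]]
    by simp
qed

text \<open>\<^typ>\<open>enat\<close> with its order topology is the ordinal space $[0,\omega]$, with \<open>\<infinity>\<close> as
  the ordinal $\omega$.\<close>

instance enat :: compact_hausdorff_space
proof
  show "compact (UNIV :: enat set)"
  proof (rule compactI)
    fix C :: "enat set set"
    assume op: "\<forall>B\<in>C. open B" and cov: "UNIV \<subseteq> \<Union>C"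
    obtain V where V: "V \<in> C" "\<infinity> \<in> V" using cov by blast
    then obtain n where n: "{enat n<..} \<subseteq> V"
      using op open_enat_iff by blast
    have "\<forall>x. \<exists>B. B \<in> C \<and> x \<in> B" using cov by blast
    then obtain g where g: "\<And>x. g x \<in> C \<and> x \<in> g x" by metis
    have "finite {..enat n}" by (rule finite_enat_bounded[of _ n]) auto
    moreover have "UNIV \<subseteq> \<Union>(insert V (g ` {..enat n}))"
    proof
      fix x :: enat
      show "x \<in> \<Union>(insert V (g ` {..enat n}))"
      proof (cases "x \<le> enat n")
        case True
        then show ?thesis using g[of x] by blast
      next
        case False
        then have "x \<in> {enat n<..}" by simp
        then show ?thesis using n by blast
      qed
    qed
    moreover have "insert V (g ` {..enat n}) \<subseteq> C" using V g by blast
    ultimately show "\<exists>C'\<subseteq>C. finite C' \<and> UNIV \<subseteq> \<Union>C'"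
      by (meson finite.insertI finite_imageI)
  qed
qed

text \<open>On a compact space every continuous function is bounded, so the library type
  \<open>'k \<Rightarrow>\<^sub>C real\<close> of bounded continuous functions with the supremum norm is $C(K)$.\<close>

type_synonym 'k CK = "'k \<Rightarrow>\<^sub>C real"

definition banach_isomorphism ::
  "('a::real_normed_vector \<Rightarrow> 'b::real_normed_vector) \<Rightarrow> bool" where
  "banach_isomorphism T \<longleftrightarrow> bounded_linear T \<and> bij T \<and> bounded_linear (inv T)"

definition positive_operator ::
  "('k::compact_hausdorff_space CK \<Rightarrow> 'l::compact_hausdorff_space CK) \<Rightarrow> bool" where
  "positive_operator T \<longleftrightarrow>
     (\<forall>f. (\<forall>x. 0 \<le> apply_bcontfun f x) \<longrightarrow> (\<forall>y. 0 \<le> apply_bcontfun (T f) y))"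

text \<open>The infimum is taken in the extended reals, so it is \<open>\<infinity>\<close> if there is no positive
  isomorphism.\<close>

definition positive_BM_distance ::
  "'k::compact_hausdorff_space itself \<Rightarrow> 'l::compact_hausdorff_space itself \<Rightarrow> ereal" where
  "positive_BM_distance _ _ =
     (INF T \<in> {T :: 'k CK \<Rightarrow> 'l CK. banach_isomorphism T \<and> positive_operator T}.
        ereal (onorm T * onorm (inv T)))"

end

theory Submission
  imports Defs
begin

text \<open>
  Scale a positive isomorphism \<open>T\<close> so that \<open>norm f \<le> norm (T f) \<le> D * norm f\<close>; then \<open>D\<close> is
  the distortion, and $D \ge 3 + 2/D$ has to be shown.  Evaluation of \<open>T f\<close> at a point is
  integration against a positive measure of mass at most \<open>D\<close>.  Let $a_i$ be the mass which the
  measure at \<open>\<infinity>\<close> gives to the point $(\infty, i)$.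

  Positivity enters through \<open>eventually_T_point_le\<close>: almost all the functions \<open>T (point k i)\<close>
  stay below $a_i + \varepsilon$, because a large value near \<open>\<infinity>\<close> would have to show up in the mass
  $a_i$.  Subtracting the multiple of such a bump that pushes \<open>T f\<close> from its value at
  \<open>\<infinity>\<close> down to \<open>- norm (T f)\<close> hardly raises the norm of \<open>T f\<close>, and as \<open>T\<close> does not decrease
  norms, the changed \<open>f\<close> stays above about \<open>- norm (T f)\<close>.  This gives
  \[ a_i f(\infty, i) \ge T f(\infty) - (a_i - 1) \|T f\| \]
  (\<open>value_at_limit_ge\<close>).  For $f = T^{-1} 1_{[N,\infty]}$ this says
  $a_i (1 + f(\infty,i)) \ge 2$, and inserting both bounds into
  $T f(\infty) \ge - D + \sum_i a_i (1 + f(\infty,i))$ (\<open>T_at_infinity_ge\<close>) yields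
  $1 \ge 4 - D$.

  The remaining summand $2/D$ comes from the fact that there are two limit points in the domain
  and one in the range.  A suitable combination $F$ of the indicators of small neighbourhoods of
  $(\infty,0)$ and $(\infty,1)$, with weights $a_1$ and $- a_0$, has $T F$ almost zero near \<open>\<infinity>\<close>,
  while $\|T F\| \le 1$ and $a_i |F(\infty,i)| \ge 1/D$.  For large $N$ the functions
  $1_{[N,\infty]} \pm T F$ have norm about one, so the lower bound above holds for
  $f(\infty,i) \pm F(\infty,i)$ and thus improves by $1/D$ for each of the two points.
\<close>

section \<open>Continuous functions on the convergent sequence\<close>

definition clopen_ind :: "'a::topological_space set \<Rightarrow> 'a \<Rightarrow>\<^sub>C real" where
  "clopen_ind S = Bcontfun (indicator S)"

lemma apply_clopen_ind:
  assumes "open S" "closed S"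
  shows "apply_bcontfun (clopen_ind S) = indicator S"
proof -
  have "open (indicator S -` B :: 'a set)" for B :: "real set"
  proof -
    have "indicator S -` B = (if 1 \<in> B then S else {}) \<union> (if 0 \<in> B then - S else {})"
      by (auto simp: indicator_def of_bool_def split: if_splits)
    then show ?thesis
      using assms by (simp add: open_Un open_Compl)
  qed
  then have "continuous_on UNIV (indicator S :: 'a \<Rightarrow> real)"
    by (simp add: continuous_on_open_vimage)
  moreover have "bounded (range (indicator S :: 'a \<Rightarrow> real))"
    by (rule boundedI[of _ 1]) (auto simp: indicator_def)
  ultimately have "(indicator S :: 'a \<Rightarrow> real) \<in> bcontfun"
    by (simp add: bcontfun_def)
  then show ?thesis
    by (simp add: clopen_ind_def Bcontfun_inverse)
qed

lemma open_enat_atLeast: "open {enat m..}"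
  unfolding open_enat_iff by (auto intro!: exI[of _ m])

lemma closed_enat_atLeast: "closed {enat m..}"
  unfolding closed_def open_enat_iff by auto

lemma open_enat_singleton: "open {enat k}"
  unfolding open_enat_iff by auto

lemma open_bool: "open (S :: bool set)"
  by (simp add: open_discrete)

lemma closed_bool: "closed (S :: bool set)"
  by (simp add: closed_def open_discrete)

abbreviation point :: "nat \<Rightarrow> bool \<Rightarrow> (enat \<times> bool) CK" where
  "point k i \<equiv> clopen_ind {(enat k, i)}"

abbreviation tail :: "nat \<Rightarrow> bool \<Rightarrow> (enat \<times> bool) CK" where
  "tail m i \<equiv> clopen_ind ({enat m..} \<times> {i})"

lemma apply_point: "point k i p = (if p = (enat k, i) then 1 else 0)"
proof -
  have "open ({enat k} \<times> {i})"
    by (rule open_Times[OF open_enat_singleton open_bool])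
  then show ?thesis
    by (simp add: apply_clopen_ind indicator_def)
qed

lemma apply_tail: "tail m i p = (if enat m \<le> fst p \<and> snd p = i then 1 else 0)"
  by (cases p, subst apply_clopen_ind)
    (auto simp: open_Times closed_Times open_enat_atLeast closed_enat_atLeast open_bool
      closed_bool indicator_def)

lemma apply_ind_atLeast: "clopen_ind {enat m..} y = (if enat m \<le> y then 1 else 0)"
  by (subst apply_clopen_ind)
    (auto simp: open_enat_atLeast closed_enat_atLeast indicator_def)

lemma apply_ind_UNIV: "clopen_ind UNIV p = 1"
  by (simp add: apply_clopen_ind)

lemma continuous_enat_near_infinity:
  fixes g :: "enat \<Rightarrow> real"
  assumes "continuous_on UNIV g" "0 < e"
  obtains m where "\<And>y. enat m \<le> y \<Longrightarrow> \<bar>g y - g \<infinity>\<bar> < e"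
proof -
  have "open (g -` ball (g \<infinity>) e)"
    using assms(1) by (simp add: open_vimage)
  moreover have "\<infinity> \<in> g -` ball (g \<infinity>) e"
    using assms(2) by simp
  ultimately obtain n where n: "{enat n<..} \<subseteq> g -` ball (g \<infinity>) e"
    unfolding open_enat_iff by blast
  show thesis
  proof (rule that[of "Suc n"])
    fix y assume "enat (Suc n) \<le> y"
    then have "y \<in> {enat n<..}"
      by (metis Suc_ile_eq greaterThan_iff)
    then show "\<bar>g y - g \<infinity>\<bar> < e"
      using n by (auto simp: dist_real_def abs_minus_commute)
  qed
qed

lemma CK_near_infinity:
  fixes g :: "enat CK"
  assumes "0 < e"
  obtains m where "\<And>y. enat m \<le> y \<Longrightarrow> \<bar>g y - g \<infinity>\<bar> < e"
  using continuous_enat_near_infinity[of "apply_bcontfun g" e] assms by auto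

lemma CK_near_limit_point:
  fixes f :: "(enat \<times> bool) CK"
  assumes "0 < e"
  obtains m where "\<And>x. enat m \<le> x \<Longrightarrow> \<bar>f (x, i) - f (\<infinity>, i)\<bar> < e"
proof -
  have "continuous_on UNIV (\<lambda>x. f (x, i))"
    by (rule continuous_on_compose2[of UNIV "apply_bcontfun f"]) (auto intro!: continuous_intros)
  from continuous_enat_near_infinity[OF this assms] that show thesis by blast
qed

lemma le_if_le_linear_perturbation:
  fixes x y C :: real
  assumes "\<And>e. 0 < e \<Longrightarrow> e < 1 \<Longrightarrow> x \<le> y + C * e"
  shows "x \<le> y"
proof (rule tendsto_lowerbound)
  show "((\<lambda>e. y + C * e) \<longlongrightarrow> y) (at_right 0)"
    by (auto intro!: tendsto_eq_intros)
  have "\<forall>\<^sub>F e in at_right (0::real). 0 < e \<and> e < 1"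
    unfolding eventually_at_right_field by (rule exI[of _ 1]) auto
  then show "\<forall>\<^sub>F e in at_right 0. x \<le> y + C * e"
    by eventually_elim (use assms in auto)
qed auto

section \<open>Positive operators that do not decrease the norm\<close>

locale expanding_positive_operator =
  fixes T :: "(enat \<times> bool) CK \<Rightarrow> enat CK" and D :: real
  assumes lin: "linear T"
    and pos: "positive_operator T"
    and upper: "norm (T f) \<le> D * norm f"
    and lower: "norm f \<le> norm (T f)"
begin

lemma T_nonneg:
  fixes f :: "(enat \<times> bool) CK"
  shows "(\<And>p. 0 \<le> f p) \<Longrightarrow> 0 \<le> T f y"
  using pos unfolding positive_operator_def by blast

lemma T_mono:
  fixes f g :: "(enat \<times> bool) CK"
  assumes "\<And>p. f p \<le> g p"
  shows "T f y \<le> T g y"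
proof -
  have "0 \<le> T (g - f) y"
    by (rule T_nonneg) (simp add: minus_bcontfun.rep_eq assms)
  then show ?thesis
    by (simp add: linear_diff[OF lin] minus_bcontfun.rep_eq)
qed

lemma norm_ind_UNIV: "norm (clopen_ind UNIV :: (enat \<times> bool) CK) = 1"
proof (rule antisym)
  show "norm (clopen_ind UNIV :: (enat \<times> bool) CK) \<le> 1"
    by (rule norm_bound) (simp add: apply_ind_UNIV)
  show "1 \<le> norm (clopen_ind UNIV :: (enat \<times> bool) CK)"
    using norm_bounded[of "clopen_ind UNIV :: (enat \<times> bool) CK" "(\<infinity>, True)"]
    by (simp add: apply_ind_UNIV)
qed

lemma T_one_le: "T (clopen_ind UNIV) y \<le> D"
  using norm_bounded[of "T (clopen_ind UNIV)" y] upper[of "clopen_ind UNIV"] norm_ind_UNIV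
  by simp

lemma T_le_D:
  fixes f :: "(enat \<times> bool) CK"
  shows "(\<And>p. f p \<le> 1) \<Longrightarrow> T f y \<le> D"
  using T_mono[of f "clopen_ind UNIV" y] T_one_le[of y] by (simp add: apply_ind_UNIV)

lemma T_point_nonneg: "0 \<le> T (point k i) y"
  by (rule T_nonneg) (simp add: apply_point)

lemma T_tail_nonneg: "0 \<le> T (tail m i) y"
  by (rule T_nonneg) (simp add: apply_tail)

lemma T_tail_antimono: "m \<le> n \<Longrightarrow> T (tail n i) y \<le> T (tail m i) y"
  by (rule T_mono) (auto simp: apply_tail intro: order_trans[of "enat m" "enat n"])

text \<open>The measure representing \<open>\<lambda>f. T f \<infinity>\<close> gives this mass to the point \<open>(\<infinity>, i)\<close>.\<close>

definition limit_mass :: "bool \<Rightarrow> real" where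
  "limit_mass i = (INF m. T (tail m i) \<infinity>)"

lemma bdd_below_T_tail: "bdd_below (range (\<lambda>m. T (tail m i) \<infinity>))"
  by (rule bdd_belowI[of _ 0]) (auto simp: T_tail_nonneg)

lemma limit_mass_le: "limit_mass i \<le> T (tail m i) \<infinity>"
  unfolding limit_mass_def by (rule cINF_lower[OF bdd_below_T_tail]) simp

lemma limit_mass_nonneg: "0 \<le> limit_mass i"
  unfolding limit_mass_def by (rule cINF_greatest) (auto simp: T_tail_nonneg)

lemma limit_mass_le_D: "limit_mass i \<le> D"
proof -
  have "T (tail 0 i) \<infinity> \<le> D"
    by (rule T_le_D) (simp add: apply_tail)
  then show ?thesis
    using limit_mass_le[of i 0] by simp
qed

lemma limit_mass_approx:
  assumes "0 < e"
  obtains m where "\<And>n. m \<le> n \<Longrightarrow> T (tail n i) \<infinity> < limit_mass i + e"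
proof -
  have "limit_mass i < limit_mass i + e"
    using assms by simp
  then obtain m where "T (tail m i) \<infinity> < limit_mass i + e"
    by (subst (asm) (1) limit_mass_def)
      (auto simp: cINF_less_iff[OF _ bdd_below_T_tail])
  then show thesis
    using that[of m] T_tail_antimono[of m _ i \<infinity>] by (meson le_less_trans)
qed

text \<open>For fixed \<open>y\<close>, the partial sums of \<open>T (point k i) y\<close> over \<open>k\<close> are bounded by \<open>D\<close>.\<close>

lemma T_point_tendsto_0: "(\<lambda>k. T (point k i) y) \<longlonglongrightarrow> 0"
proof -
  have "(\<Sum>k<n. T (point k i) y) \<le> D" for n
  proof -
    have apply_sum: "apply_bcontfun (sum g A) p = (\<Sum>k\<in>A. g k p)"
      for g :: "nat \<Rightarrow> 'b::topological_space CK" and A p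
      by (induction A rule: infinite_finite_induct) (auto simp: plus_bcontfun.rep_eq)
    have "(\<Sum>k<n. T (point k i) y) = T (\<Sum>k<n. point k i) y"
      by (simp add: linear_sum[OF lin] apply_sum)
    also have "\<dots> \<le> D"
    proof (rule T_le_D)
      fix p :: "enat \<times> bool"
      obtain x j where p: "p = (x, j)" by (cases p)
      show "(\<Sum>k<n. point k i) p \<le> 1"
      proof (cases "j = i")
        case True
        then show ?thesis
          by (cases x) (auto simp: p apply_sum apply_point)
      next
        case False
        then show ?thesis
          by (simp add: p apply_sum apply_point)
      qed
    qed
    finally show ?thesis .
  qed
  then have "summable (\<lambda>k. T (point k i) y)"
    by (intro summableI_nonneg_bounded[of _ D]) (auto simp: T_point_nonneg)
  then show ?thesis
    by (rule summable_LIMSEQ_zero)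
qed

lemma eventually_T_point_small:
  assumes "0 < e"
  shows "\<forall>\<^sub>F k in sequentially. \<forall>y<enat N. T (point k i) y < e"
proof -
  have "\<forall>\<^sub>F k in sequentially. \<forall>n\<in>{..<N}. T (point k i) (enat n) < e"
    using assms
    by (intro eventually_ball_finite ballI order_tendstoD(2)[OF T_point_tendsto_0]) auto
  then show ?thesis
    by eventually_elim (metis enat_iless enat_ord_simps(2) lessThan_iff)
qed

text \<open>Near \<open>\<infinity>\<close> the bump is dominated by \<open>T (tail m i)\<close>, whose value at \<open>\<infinity>\<close> is close to the limit
  mass; the finitely many other points only see a small part of a late bump.\<close>

lemma eventually_T_point_le:
  assumes "0 < e"
  shows "\<forall>\<^sub>F k in sequentially. \<forall>y. T (point k i) y \<le> limit_mass i + e"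
proof -
  obtain m where m: "T (tail m i) \<infinity> < limit_mass i + e / 2"
    using limit_mass_approx[of "e / 2" i] assms by auto
  obtain N where N: "\<And>y. enat N \<le> y \<Longrightarrow> \<bar>T (tail m i) y - T (tail m i) \<infinity>\<bar> < e / 2"
    using CK_near_infinity[of "e / 2" "T (tail m i)"] assms by auto
  show ?thesis
    using eventually_T_point_small[OF assms, of N i] eventually_ge_at_top[of m]
  proof eventually_elim
    case (elim k)
    show ?case
    proof
      fix y
      show "T (point k i) y \<le> limit_mass i + e"
      proof (cases "y < enat N")
        case True
        then show ?thesis
          using elim(1) limit_mass_nonneg[of i] by (meson add_increasing less_imp_le)
      next
        case False
        have "T (point k i) y \<le> T (tail m i) y"
          using elim(2) by (intro T_mono) (auto simp: apply_point apply_tail)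
        moreover have "\<bar>T (tail m i) y - T (tail m i) \<infinity>\<bar> < e / 2"
          using N False by simp
        ultimately show ?thesis
          using m by linarith
      qed
    qed
  qed
qed

lemma one_le_limit_mass: "1 \<le> limit_mass i"
proof (rule field_le_epsilon)
  fix e :: real assume "0 < e"
  then obtain k where k: "\<And>y. T (point k i) y \<le> limit_mass i + e"
    using eventually_happens'[OF sequentially_bot eventually_T_point_le[of e i]] by auto
  have "1 \<le> norm (point k i)"
    using norm_bounded[of "point k i" "(enat k, i)"] by (simp add: apply_point)
  also have "\<dots> \<le> norm (T (point k i))"
    by (rule lower)
  also have "\<dots> \<le> limit_mass i + e"
    by (rule norm_bound) (simp add: T_point_nonneg k)
  finally show "1 \<le> limit_mass i + e" .
qed

text \<open>A late bump in \<open>f\<close> moves \<open>T f\<close> only near \<open>\<infinity>\<close>.  As \<open>T f \<infinity> + norm (T f)\<close> is the room for going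
  down there and the bump is at most \<open>limit_mass i\<close> high, the multiple with the quotient of the
  two as a factor may be subtracted; up to an arbitrarily small error, the new value of \<open>f\<close> at
  the bump is still at least \<open>- norm (T f)\<close>, because \<open>T\<close> does not decrease the norm.\<close>

lemma value_at_limit_ge:
  fixes f :: "(enat \<times> bool) CK"
  shows "T f \<infinity> - (limit_mass i - 1) * norm (T f) \<le> limit_mass i * f (\<infinity>, i)"
proof -
  define w where "w = T f \<infinity>"
  define c where "c = norm (T f)"
  define a where "a = limit_mass i"
  define s where "s = f (\<infinity>, i)"
  have a: "1 \<le> a"
    using one_le_limit_mass by (simp add: a_def)
  have Tf: "\<bar>T f y\<bar> \<le> c" for y
    using norm_bounded[of "T f" y] by (simp add: c_def)
  have w: "\<bar>w\<bar> \<le> c"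
    unfolding w_def by (rule Tf)
  have "w - (a - 1) * c \<le> a * s"
  proof (rule le_if_le_linear_perturbation)
    fix e :: real assume e: "0 < e" "e < 1"
    define u where "u = (w + c) / (a + e)"
    have u0: "0 \<le> u"
      using w a e by (simp add: u_def)
    have u: "u * (a + e) = w + c"
      using a e by (simp add: u_def)
    have "u * 1 \<le> u * (a + e)"
      using u0 a e by (intro mult_left_mono) auto
    then have u2: "u \<le> 2 * c"
      using u w by simp
    obtain N where N: "\<And>y. enat N \<le> y \<Longrightarrow> \<bar>T f y - w\<bar> < e"
      using CK_near_infinity[OF e(1), of "T f"] by (auto simp: w_def)
    obtain m where m: "\<And>x. enat m \<le> x \<Longrightarrow> \<bar>f (x, i) - s\<bar> < e"
      using CK_near_limit_point[OF e(1), of f i] by (auto simp: s_def)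
    have "\<forall>\<^sub>F k in sequentially. m \<le> k \<and> (\<forall>y<enat N. T (point k i) y < e)
        \<and> (\<forall>y. T (point k i) y \<le> a + e)"
      using eventually_ge_at_top eventually_T_point_small[OF e(1)] eventually_T_point_le[OF e(1)]
      unfolding a_def by (intro eventually_conj)
    then obtain k where k: "m \<le> k" "\<And>y. y < enat N \<Longrightarrow> T (point k i) y < e"
        "\<And>y. T (point k i) y \<le> a + e"
      using eventually_happens'[OF sequentially_bot] by blast
    define f' where "f' = f - u *\<^sub>R point k i"
    have Tf': "T f' y = T f y - u * T (point k i) y" for y
      by (simp add: f'_def linear_diff[OF lin] linear_cmul[OF lin] minus_bcontfun.rep_eq
          scaleR_bcontfun.rep_eq)
    have "\<bar>T f' y\<bar> \<le> c + (1 + 2 * c) * e" for y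
    proof -
      have c0: "0 \<le> c" by (simp add: c_def)
      have p0: "0 \<le> u * T (point k i) y"
        by (intro mult_nonneg_nonneg u0 T_point_nonneg)
      have "0 \<le> c * e" using c0 e by simp
      show ?thesis
      proof (cases "y < enat N")
        case True
        have "u * T (point k i) y \<le> (2 * c) * e"
          using k(2)[OF True] by (intro mult_mono u2) (auto simp: T_point_nonneg c0)
        then show ?thesis
          using Tf[of y] p0 e by (simp add: Tf' algebra_simps abs_le_iff)
      next
        case False
        have "u * T (point k i) y \<le> w + c"
          using mult_left_mono[OF k(3)[of y] u0] u by simp
        moreover have "\<bar>T f y - w\<bar> < e"
          using N False by simp
        moreover have "(1 + 2 * c) * e = e + 2 * (c * e)"
          by (simp add: algebra_simps)
        ultimately show ?thesis
          using Tf[of y] p0 \<open>0 \<le> c * e\<close> unfolding Tf' by linarith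
      qed
    qed
    then have "norm (T f') \<le> c + (1 + 2 * c) * e"
      by (intro norm_bound) simp
    then have "\<bar>f' (enat k, i)\<bar> \<le> c + (1 + 2 * c) * e"
      using lower[of f'] norm_bounded[of f' "(enat k, i)"] by simp
    then have "u - c - (1 + 2 * c) * e \<le> f (enat k, i)"
      by (simp add: f'_def minus_bcontfun.rep_eq scaleR_bcontfun.rep_eq apply_point)
    moreover have "f (enat k, i) < s + e"
      using m[of "enat k"] k(1) by auto
    ultimately have "u - c - (2 + 2 * c) * e \<le> s"
      by (simp add: algebra_simps)
    then have "(a + e) * (u - c - (2 + 2 * c) * e) \<le> (a + e) * s"
      using a e by (intro mult_left_mono) auto
    then have "w + c - (a + e) * c - (a + e) * ((2 + 2 * c) * e) \<le> (a + e) * s"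
      using u by (simp add: algebra_simps)
    moreover have "(a + e) * ((2 + 2 * c) * e) \<le> (a + 1) * ((2 + 2 * c) * e)"
      using e by (intro mult_right_mono) (auto simp: c_def)
    ultimately show "w - (a - 1) * c \<le> a * s + (s + c + (a + 1) * (2 + 2 * c)) * e"
      by (simp add: algebra_simps)
  qed
  then show ?thesis
    by (simp add: w_def c_def a_def s_def)
qed

text \<open>The part of the mass at \<open>\<infinity>\<close> that does not sit in the two limit points contributes at least
  its negative, since \<open>f\<close> is bounded below by \<open>- 1\<close>.\<close>

lemma T_at_infinity_ge:
  fixes f :: "(enat \<times> bool) CK"
  assumes "norm f \<le> 1"
  shows "(1 + f (\<infinity>, False)) * limit_mass False + (1 + f (\<infinity>, True)) * limit_mass True
    \<le> T f \<infinity> + D"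
proof (rule le_if_le_linear_perturbation)
  fix e :: real assume e: "0 < e" "e < 1"
  have f: "\<bar>f p\<bar> \<le> 1" for p
    using norm_bounded[of f p] assms by simp
  have "\<exists>m. \<forall>x\<ge>enat m. \<bar>f (x, i) - f (\<infinity>, i)\<bar> < e" for i
    using CK_near_limit_point[OF e(1), of f i] by metis
  then obtain m where m: "\<And>i x. enat (m i) \<le> x \<Longrightarrow> \<bar>f (x, i) - f (\<infinity>, i)\<bar> < e"
    by metis
  let ?t = "\<lambda>i. tail (m i) i"
  have c: "0 \<le> 1 + f (\<infinity>, i)" for i
    using f[of "(\<infinity>, i)"] by simp
  have "T ((1 + f (\<infinity>, False)) *\<^sub>R ?t False + (1 + f (\<infinity>, True)) *\<^sub>R ?t True) \<infinity>
      \<le> T (f + (1 + e) *\<^sub>R clopen_ind UNIV) \<infinity>"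
  proof (rule T_mono)
    fix p :: "enat \<times> bool"
    obtain x i where p: "p = (x, i)" by (cases p)
    show "((1 + f (\<infinity>, False)) *\<^sub>R ?t False + (1 + f (\<infinity>, True)) *\<^sub>R ?t True) p
        \<le> (f + (1 + e) *\<^sub>R clopen_ind UNIV) p"
      using m[of i x] f[of p] e unfolding p
      by (cases i) (auto simp: plus_bcontfun.rep_eq scaleR_bcontfun.rep_eq apply_tail
          apply_ind_UNIV abs_le_iff abs_less_iff)
  qed
  then have "(1 + f (\<infinity>, False)) * T (?t False) \<infinity> + (1 + f (\<infinity>, True)) * T (?t True) \<infinity>
      \<le> T f \<infinity> + (1 + e) * T (clopen_ind UNIV) \<infinity>"
    by (simp add: linear_add[OF lin] linear_cmul[OF lin] plus_bcontfun.rep_eq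
        scaleR_bcontfun.rep_eq)
  moreover have "(1 + f (\<infinity>, i)) * limit_mass i \<le> (1 + f (\<infinity>, i)) * T (?t i) \<infinity>" for i
    by (intro mult_left_mono limit_mass_le c)
  note this[of False] this[of True]
  moreover have "(1 + e) * T (clopen_ind UNIV) \<infinity> \<le> (1 + e) * D"
    using e by (intro mult_left_mono T_one_le) auto
  ultimately show "(1 + f (\<infinity>, False)) * limit_mass False
      + (1 + f (\<infinity>, True)) * limit_mass True \<le> T f \<infinity> + D + D * e"
    by (simp add: algebra_simps)
qed

section \<open>The gain from two limit points over one\<close>

lemma D_pos: "0 < D"
  using one_le_limit_mass[of True] limit_mass_le_D[of True] by simp

text \<open>The two indicators enter with opposite signs and both have nonnegative images, of sum at
  most \<open>D\<close>; so the larger limit mass times \<open>D\<close> normalises the combination.  What remains of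
  \<open>limit_mass i * \<bar>F (\<infinity>, i)\<bar>\<close> is the smaller limit mass divided by \<open>D\<close>.\<close>

lemma exists_almost_annihilated:
  assumes e: "0 < e"
  obtains F :: "(enat \<times> bool) CK" where "\<And>y. \<bar>T F y\<bar> \<le> 1" "\<bar>T F \<infinity>\<bar> < e"
    "\<And>i. 1 / D \<le> limit_mass i * \<bar>F (\<infinity>, i)\<bar>"
proof -
  define a where "a = limit_mass False"
  define b where "b = limit_mass True"
  define M where "M = max a b"
  have ab: "1 \<le> a" "1 \<le> b"
    by (auto simp: a_def b_def one_le_limit_mass)
  have M: "a \<le> M" "b \<le> M" "1 \<le> M"
    using ab by (auto simp: M_def)
  have DM: "0 < D * M"
    using D_pos M by simp
  have eD: "0 < e * D"
    using e D_pos by simp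
  obtain m0 where m0: "\<And>n. m0 \<le> n \<Longrightarrow> T (tail n False) \<infinity> < a + e * D"
    using limit_mass_approx[OF eD, of False] by (auto simp: a_def)
  obtain m1 where m1: "\<And>n. m1 \<le> n \<Longrightarrow> T (tail n True) \<infinity> < b + e * D"
    using limit_mass_approx[OF eD, of True] by (auto simp: b_def)
  define m where "m = max m0 m1"
  define p where "p = (\<lambda>y. T (tail m False) y)"
  define q where "q = (\<lambda>y. T (tail m True) y)"
  define F where "F = (1 / (D * M)) *\<^sub>R (b *\<^sub>R tail m False - a *\<^sub>R tail m True)"
  have TF: "T F y = (b * p y - a * q y) / (D * M)" for y
    by (simp add: F_def p_def q_def linear_diff[OF lin] linear_cmul[OF lin]
        minus_bcontfun.rep_eq scaleR_bcontfun.rep_eq)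
  have pq0: "0 \<le> p y" "0 \<le> q y" for y
    by (auto simp: p_def q_def T_tail_nonneg)
  have pD: "p y \<le> D" and qD: "q y \<le> D" for y
    unfolding p_def q_def by (rule T_le_D, simp add: apply_tail)+
  show thesis
  proof (rule that[of F])
    fix y
    have "b * p y \<le> M * D" "a * q y \<le> M * D" "0 \<le> b * p y" "0 \<le> a * q y"
      using M ab pq0[of y] pD[of y] qD[of y] by (auto intro!: mult_mono)
    then have "\<bar>b * p y - a * q y\<bar> \<le> D * M"
      by (simp add: abs_le_iff mult.commute)
    then show "\<bar>T F y\<bar> \<le> 1"
      using DM by (simp add: TF)
  next
    have "a \<le> p \<infinity>" "b \<le> q \<infinity>"
      by (auto simp: a_def b_def p_def q_def limit_mass_le)
    moreover have "p \<infinity> < a + e * D" "q \<infinity> < b + e * D"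
      using m0[of m] m1[of m] by (auto simp: p_def q_def m_def)
    ultimately have "b * a \<le> b * p \<infinity>" "a * b \<le> a * q \<infinity>"
        "b * p \<infinity> < b * (a + e * D)" "a * q \<infinity> < a * (b + e * D)"
      using ab by auto
    moreover have "b * (e * D) \<le> M * (e * D)" "a * (e * D) \<le> M * (e * D)"
      using M eD by (auto intro!: mult_right_mono simp del: mult_le_cancel_right_pos)
    ultimately have "\<bar>b * p \<infinity> - a * q \<infinity>\<bar> < e * (D * M)"
      by (simp add: abs_less_iff algebra_simps)
    then show "\<bar>T F \<infinity>\<bar> < e"
      using DM by (simp add: TF field_simps)
  next
    fix i
    have "limit_mass i * \<bar>F (\<infinity>, i)\<bar> = a * b / (D * M)"
      using ab DM M D_pos
      by (cases i) (auto simp: F_def minus_bcontfun.rep_eq scaleR_bcontfun.rep_eq apply_tail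
          a_def b_def abs_mult)
    moreover have "M \<le> a * b"
      using ab by (auto simp: M_def)
    ultimately show "1 / D \<le> limit_mass i * \<bar>F (\<infinity>, i)\<bar>"
      using DM D_pos by (simp add: field_simps)
  qed
qed

lemma distortion_ge:
  assumes surj: "surj T"
  shows "3 + 2 / D \<le> D"
proof (rule le_if_le_linear_perturbation)
  fix e :: real assume e: "0 < e" "e < 1"
  obtain F :: "(enat \<times> bool) CK" where F: "\<And>y. \<bar>T F y\<bar> \<le> 1" "\<bar>T F \<infinity>\<bar> < e / 2"
      "\<And>i. 1 / D \<le> limit_mass i * \<bar>F (\<infinity>, i)\<bar>"
    using exists_almost_annihilated[of "e / 2"] e by auto
  obtain N where N: "\<And>y. enat N \<le> y \<Longrightarrow> \<bar>T F y - T F \<infinity>\<bar> < e / 2"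
    using CK_near_infinity[of "e / 2" "T F"] e by auto
  obtain f where f: "T f = clopen_ind {enat N..}"
    using surj by (metis surjD)
  have Tf: "T f y = (if enat N \<le> y then 1 else 0)" for y
    by (simp add: f apply_ind_atLeast)
  have "norm (T f) \<le> 1"
    by (rule norm_bound) (simp add: Tf)
  then have nf: "norm f \<le> 1"
    using lower[of f] by simp
  have bound: "2 - limit_mass i + 1 / D - e - D * e \<le> limit_mass i * f (\<infinity>, i)" for i
  proof -
    \<comment> \<open>The sign makes the perturbation lower the value at \<open>(\<infinity>, i)\<close>.\<close>
    define r where "r = (if 0 \<le> F (\<infinity>, i) then - 1 else 1 :: real)"
    define g where "g = f + r *\<^sub>R F"
    have r: "\<bar>r\<bar> = 1" "r * F (\<infinity>, i) = - \<bar>F (\<infinity>, i)\<bar>"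
      by (auto simp: r_def)
    have Tg: "T g y = T f y + r * T F y" for y
      by (simp add: g_def linear_add[OF lin] linear_cmul[OF lin] plus_bcontfun.rep_eq
          scaleR_bcontfun.rep_eq)
    have rT: "\<bar>r * T F y\<bar> = \<bar>T F y\<bar>" for y
      by (simp add: abs_mult r)
    have "norm (T g) \<le> 1 + e"
    proof (rule norm_bound)
      fix y
      show "norm (T g y) \<le> 1 + e"
      proof (cases "enat N \<le> y")
        case True
        then have "\<bar>T F y\<bar> < e"
          using N[OF True] F(2) by linarith
        then show ?thesis
          using rT[of y] True by (simp add: Tg Tf)
      next
        case False
        then show ?thesis
          using rT[of y] F(1)[of y] e by (simp add: Tg Tf)
      qed
    qed
    then have "(limit_mass i - 1) * norm (T g) \<le> (limit_mass i - 1) * (1 + e)"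
      using one_le_limit_mass[of i] by (intro mult_left_mono) auto
    moreover have "1 - e \<le> T g \<infinity>"
      using rT[of \<infinity>] F(2) e by (simp add: Tg Tf)
    ultimately have "1 - e - (limit_mass i - 1) * (1 + e) \<le> limit_mass i * g (\<infinity>, i)"
      using value_at_limit_ge[of g i] by linarith
    also have "g (\<infinity>, i) = f (\<infinity>, i) - \<bar>F (\<infinity>, i)\<bar>"
      by (simp add: g_def plus_bcontfun.rep_eq scaleR_bcontfun.rep_eq r)
    finally have "2 - limit_mass i - limit_mass i * e + limit_mass i * \<bar>F (\<infinity>, i)\<bar>
        \<le> limit_mass i * f (\<infinity>, i)"
      by (simp add: algebra_simps)
    moreover have "limit_mass i * e \<le> D * e"
      using limit_mass_le_D[of i] e by (intro mult_right_mono) auto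
    ultimately show ?thesis
      using F(3)[of i] e by linarith
  qed
  show "3 + 2 / D \<le> D + (2 * (1 + D)) * e"
    using T_at_infinity_ge[OF nf] bound[of False] bound[of True]
    by (simp add: Tf algebra_simps)
qed

end

section \<open>The positive Banach--Mazur distance\<close>

lemma distortion_of_positive_isomorphism:
  fixes T :: "(enat \<times> bool) CK \<Rightarrow> enat CK"
  assumes iso: "banach_isomorphism T" and pos: "positive_operator T"
  defines "D \<equiv> onorm T * onorm (inv T)"
  shows "0 < D" "3 + 2 / D \<le> D"
proof -
  define B where "B = onorm (inv T)"
  have bl: "bounded_linear T" "bounded_linear (inv T)" and "bij T"
    using iso by (auto simp: banach_isomorphism_def)
  have invT: "inv T (T f) = f" for f
    using \<open>bij T\<close> by (simp add: bij_is_inj)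
  have low: "norm f \<le> B * norm (T f)" for f
    using onorm[OF bl(2), of "T f"] by (simp add: invT B_def)
  have "1 \<le> norm (clopen_ind UNIV :: (enat \<times> bool) CK)"
    using norm_bounded[of "clopen_ind UNIV :: (enat \<times> bool) CK" "(\<infinity>, True)"]
    by (simp add: apply_ind_UNIV)
  then have "0 < B * norm (T (clopen_ind UNIV))"
    using low[of "clopen_ind UNIV"] by linarith
  then have B: "0 < B"
    by (simp add: zero_less_mult_iff)
  interpret expanding_positive_operator "\<lambda>f. B *\<^sub>R T f" D
  proof (rule expanding_positive_operator.intro)
    show "linear (\<lambda>f. B *\<^sub>R T f)"
      using bl(1) by (intro bounded_linear.linear bounded_linear_scaleR_right
          bounded_linear_compose[OF bounded_linear_scaleR_right])
    show "positive_operator (\<lambda>f. B *\<^sub>R T f)"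
      using pos B by (auto simp: positive_operator_def scaleR_bcontfun.rep_eq)
    show "norm (B *\<^sub>R T f) \<le> D * norm f" for f
      using mult_left_mono[OF onorm[OF bl(1), of f], of B] B
      by (simp add: D_def B_def mult_ac)
    show "norm f \<le> norm (B *\<^sub>R T f)" for f
      using low[of f] B by simp
  qed
  have "surj (\<lambda>f. B *\<^sub>R T f)"
  proof (rule surjI)
    fix g
    have "T (inv T ((1 / B) *\<^sub>R g)) = (1 / B) *\<^sub>R g"
      using \<open>bij T\<close> by (simp add: bij_is_surj surj_f_inv_f)
    then show "B *\<^sub>R T (inv T ((1 / B) *\<^sub>R g)) = g"
      using B by simp
  qed
  then show "3 + 2 / D \<le> D"
    by (rule distortion_ge)
  show "0 < D"
    by (rule D_pos)
qed

lemma ge_root_of_quadratic: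
  fixes D :: real
  assumes "0 < D" "3 + 2 / D \<le> D"
  shows "(3 + sqrt 17) / 2 \<le> D"
proof -
  have "(3 + 2 / D) * D \<le> D * D"
    using assms by (intro mult_right_mono) auto
  then have "3 * D + 2 \<le> D * D"
    using assms(1) by (simp add: algebra_simps)
  then have "17 \<le> (2 * D - 3)\<^sup>2"
    by (simp add: power2_eq_square algebra_simps)
  moreover have "0 \<le> 2 / D"
    using assms(1) by simp
  then have "0 \<le> 2 * D - 3"
    using assms by linarith
  ultimately have "sqrt 17 \<le> 2 * D - 3"
    by (intro real_le_lsqrt) auto
  then show ?thesis by simp
qed

theorem theorem3p3:
  shows "positive_BM_distance TYPE(enat \<times> bool) TYPE(enat) \<ge> ereal ((3 + sqrt 17) / 2)
       \<and> (3 + sqrt 17) / 2 > (3.56 :: real)"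
proof
  show "ereal ((3 + sqrt 17) / 2) \<le> positive_BM_distance TYPE(enat \<times> bool) TYPE(enat)"
    unfolding positive_BM_distance_def
  proof (rule INF_greatest)
    fix T :: "(enat \<times> bool) CK \<Rightarrow> enat CK"
    assume "T \<in> {T. banach_isomorphism T \<and> positive_operator T}"
    then show "ereal ((3 + sqrt 17) / 2) \<le> ereal (onorm T * onorm (inv T))"
      using ge_root_of_quadratic distortion_of_positive_isomorphism by simp
  qed
  have "(4.12 :: real) < sqrt 17"
    by (rule real_less_rsqrt) (simp add: power2_eq_square)
  then show "(3 + sqrt 17) / 2 > (3.56 :: real)"
    by simp
qed

end
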